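(* Let $\gamma>1$, $\rho_\pm>0$ and $u_-<u_+$. For small $\epsilon_1,\epsilon_2>0$, assume $(\rho^{\epsilon_1\epsilon_2},u^{\epsilon_1\epsilon_2})$ is the two-rarefaction wave solution (described in the context) of $$\rho_t+(\rho u-2\epsilon_1u)_x=0,\qquad(\rho u)_t+\Big(\rho u^2-\epsilon_1u^2+\epsilon_2\frac{\rho^\gamma}{\gamma}\Big)_x=0$$ with Riemann data $(\rho,u)(0,x)=(\rho_-,u_-)$ for $x<0$ and $(\rho_+,u_+)$ for $x>0$. Then there exists $\epsilon_0>0$ such that, whenever $0<\epsilon_1<\epsilon_0$ and $0<\epsilon_2<\epsilon_0$, the constant density solution ($\rho=2\epsilon_1$) appears in the solution. Moreover, as $\epsilon_1,\epsilon_2\to0$, the two rarefaction waves become two contact discontinuities $\xi=x/t=u_\pm$ connecting the constant states $(\rho_\pm,u_\pm)$ and the vacuum ($\rho=0$), which form a vacuum solution of the zero-pressure system $\rho_t+(\rho u)_x=0$, $(\rho u)_t+(\rho u^2)_x=0$ with the same Riemann data; that is, for every $\xi\ne u_\pm$, $(\rho^{\epsilon_1\epsilon_2},u^{\epsilon_1\epsilon_2})(\xi)$ converges to $$(\rho,u)(\xi)=\begin{cases}(\rho_-,u_-),&\xi<u_-,\\(0,\xi),&u_-\le\xi\le u_+,\\(\rho_+,u_+),&\xi>u_+.\end{cases}$$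
   Context: The perturbed system is considered for densities $\rho\ge2\epsilon_1$; its characteristic speeds are $\lambda_{1}=u-\sqrt{\epsilon_2\rho^{\gamma-2}(\rho-2\epsilon_1)}$ and $\lambda_2=u+\sqrt{\epsilon_2\rho^{\gamma-2}(\rho-2\epsilon_1)}$. A two-rarefaction wave solution is a self-similar solution $(\rho,u)(\xi)$, $\xi=x/t$, continuous in $\xi$, consisting, from left to right, of: - the constant state $(\rho_-,u_-)$; - a backward centred rarefaction wave, along which $\rho$ decreases from $\rho_-$, $\xi=\lambda_1(\rho,u)$ and $u-u_-=-\int_{\rho_-}^{\rho}\sqrt{\frac{\epsilon_2s^{\gamma-2}}{s-2\epsilon_1}}\,ds$; - an intermediate part; - a forward centred rarefaction wave, along which $\rho$ increases up to $\rho_+$, $\xi=\lambda_2(\rho,u)$ and $u_+-u=\int_{\rho}^{\rho_+}\sqrt{\frac{\epsilon_2s^{\gamma-2}}{s-2\epsilon_1}}\,ds$; - the constant state $(\rho_+,u_+)$. The intermediate part is either a constant state $(\rho_*,u_* )$ with $2\epsilon_1\le\rho_*<\min(\rho_-,\rho_+)$, or a constant density solution, i.e. $(\rho,u)(\xi)=(2\epsilon_1,\xi)$ on a nondegenerate interval of $\xi$, both rarefaction waves then extending to $\rho=2\epsilon_1$. *)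

theory Defs
  imports "HOL-Analysis.Analysis"
begin

text \<open>
  Points of the half plane are pairs \<open>(t, x)\<close>; \<open>\<phi>t\<close> and \<open>\<phi>x\<close> are the partial derivatives of
  the test function \<open>\<phi>\<close>, whose support may meet the line \<open>t = 0\<close>. Test functions are \<open>C\<^sup>1\<close>.
\<close>

definition test_function ::
    "(real \<times> real \<Rightarrow> real) \<Rightarrow> (real \<times> real \<Rightarrow> real) \<Rightarrow> (real \<times> real \<Rightarrow> real) \<Rightarrow> bool" where
  "test_function \<phi> \<phi>t \<phi>x \<longleftrightarrow>
     (\<forall>z. (\<phi> has_derivative (\<lambda>(h, k). \<phi>t z * h + \<phi>x z * k)) (at z)) \<and>
     continuous_on UNIV \<phi>t \<and> continuous_on UNIV \<phi>x \<and>
     (\<exists>K. compact K \<and> (\<forall>z. z \<notin> K \<longrightarrow> \<phi> z = 0))"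

text \<open>\<open>w\<^sub>t + f\<^sub>x = 0\<close> for \<open>t > 0\<close> with \<open>w(0, x) = w0 x\<close>, in the sense of distributions.\<close>

definition weak_conservation_law ::
    "(real \<times> real \<Rightarrow> real) \<Rightarrow> (real \<times> real \<Rightarrow> real) \<Rightarrow> (real \<Rightarrow> real) \<Rightarrow> bool" where
  "weak_conservation_law w f w0 \<longleftrightarrow>
     (\<forall>\<phi> \<phi>t \<phi>x. test_function \<phi> \<phi>t \<phi>x \<longrightarrow>
        set_integrable lborel ({0<..} \<times> UNIV) (\<lambda>z. w z * \<phi>t z + f z * \<phi>x z) \<and>
        integrable lborel (\<lambda>x. w0 x * \<phi> (0, x)) \<and>
        (LINT z:{0<..} \<times> UNIV|lborel. w z * \<phi>t z + f z * \<phi>x z)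
          + (LINT x|lborel. w0 x * \<phi> (0, x)) = 0)"

definition riemann_data :: "real \<Rightarrow> real \<Rightarrow> real \<Rightarrow> real" where
  "riemann_data l r x = (if x < 0 then l else r)"

text \<open>
  The self-similar functions \<open>\<rho>(t, x) = R (x/t)\<close>, \<open>u(t, x) = U (x/t)\<close> solve
  \<open>\<rho>\<^sub>t + f(\<rho>, u)\<^sub>x = 0\<close>, \<open>(\<rho> u)\<^sub>t + g(\<rho>, u)\<^sub>x = 0\<close> with Riemann data
  \<open>(\<rho>m, um)\<close> for \<open>x < 0\<close> and \<open>(\<rho>p, up)\<close> for \<open>x > 0\<close>.
\<close>

definition self_similar_solution ::
    "(real \<Rightarrow> real \<Rightarrow> real) \<Rightarrow> (real \<Rightarrow> real \<Rightarrow> real) \<Rightarrow> real \<Rightarrow> real \<Rightarrow> real \<Rightarrow> real \<Rightarrow>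
     (real \<Rightarrow> real) \<Rightarrow> (real \<Rightarrow> real) \<Rightarrow> bool" where
  "self_similar_solution f g \<rho>m um \<rho>p up R U \<longleftrightarrow>
     weak_conservation_law (\<lambda>(t, x). R (x / t)) (\<lambda>(t, x). f (R (x / t)) (U (x / t)))
       (riemann_data \<rho>m \<rho>p) \<and>
     weak_conservation_law (\<lambda>(t, x). R (x / t) * U (x / t)) (\<lambda>(t, x). g (R (x / t)) (U (x / t)))
       (riemann_data (\<rho>m * um) (\<rho>p * up))"

definition perturbed_mass_flux :: "real \<Rightarrow> real \<Rightarrow> real \<Rightarrow> real" where
  "perturbed_mass_flux \<epsilon>1 \<rho> u = \<rho> * u - 2 * \<epsilon>1 * u"

definition perturbed_momentum_flux :: "real \<Rightarrow> real \<Rightarrow> real \<Rightarrow> real \<Rightarrow> real \<Rightarrow> real" where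
  "perturbed_momentum_flux \<gamma> \<epsilon>1 \<epsilon>2 \<rho> u = \<rho> * u\<^sup>2 - \<epsilon>1 * u\<^sup>2 + \<epsilon>2 * (\<rho> powr \<gamma> / \<gamma>)"

definition zero_pressure_mass_flux :: "real \<Rightarrow> real \<Rightarrow> real" where
  "zero_pressure_mass_flux \<rho> u = \<rho> * u"

definition zero_pressure_momentum_flux :: "real \<Rightarrow> real \<Rightarrow> real" where
  "zero_pressure_momentum_flux \<rho> u = \<rho> * u\<^sup>2"

definition char_speed1 :: "real \<Rightarrow> real \<Rightarrow> real \<Rightarrow> real \<Rightarrow> real \<Rightarrow> real" where
  "char_speed1 \<gamma> \<epsilon>1 \<epsilon>2 \<rho> u = u - sqrt (\<epsilon>2 * \<rho> powr (\<gamma> - 2) * (\<rho> - 2 * \<epsilon>1))"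

definition char_speed2 :: "real \<Rightarrow> real \<Rightarrow> real \<Rightarrow> real \<Rightarrow> real \<Rightarrow> real" where
  "char_speed2 \<gamma> \<epsilon>1 \<epsilon>2 \<rho> u = u + sqrt (\<epsilon>2 * \<rho> powr (\<gamma> - 2) * (\<rho> - 2 * \<epsilon>1))"

text \<open>
  The oriented integral from \<open>\<rho>1\<close> to \<open>\<rho>2\<close>. For \<open>\<epsilon>1, \<epsilon>2 > 0\<close> and \<open>\<rho>1, \<rho>2 \<ge> 2 \<epsilon>1\<close> the integrand
  is Lebesgue integrable, also when an end point is the singularity \<open>2 \<epsilon>1\<close>.
\<close>

definition wave_integral :: "real \<Rightarrow> real \<Rightarrow> real \<Rightarrow> real \<Rightarrow> real \<Rightarrow> real" where
  "wave_integral \<gamma> \<epsilon>1 \<epsilon>2 \<rho>1 \<rho>2 =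
     (LBINT s=ereal \<rho>1..ereal \<rho>2. sqrt (\<epsilon>2 * s powr (\<gamma> - 2) / (s - 2 * \<epsilon>1)))"

definition backward_rarefaction ::
    "real \<Rightarrow> real \<Rightarrow> real \<Rightarrow> real \<Rightarrow> real \<Rightarrow> real \<Rightarrow> real \<Rightarrow> (real \<Rightarrow> real) \<Rightarrow> (real \<Rightarrow> real) \<Rightarrow> bool" where
  "backward_rarefaction \<gamma> \<epsilon>1 \<epsilon>2 \<rho>m um a b R U \<longleftrightarrow>
     strict_antimono_on {a..b} R \<and>
     (\<forall>\<xi>\<in>{a..b}. \<xi> = char_speed1 \<gamma> \<epsilon>1 \<epsilon>2 (R \<xi>) (U \<xi>) \<and>
                 U \<xi> - um = - wave_integral \<gamma> \<epsilon>1 \<epsilon>2 \<rho>m (R \<xi>))"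

definition forward_rarefaction ::
    "real \<Rightarrow> real \<Rightarrow> real \<Rightarrow> real \<Rightarrow> real \<Rightarrow> real \<Rightarrow> real \<Rightarrow> (real \<Rightarrow> real) \<Rightarrow> (real \<Rightarrow> real) \<Rightarrow> bool" where
  "forward_rarefaction \<gamma> \<epsilon>1 \<epsilon>2 \<rho>p up c d R U \<longleftrightarrow>
     strict_mono_on {c..d} R \<and>
     (\<forall>\<xi>\<in>{c..d}. \<xi> = char_speed2 \<gamma> \<epsilon>1 \<epsilon>2 (R \<xi>) (U \<xi>) \<and>
                 up - U \<xi> = wave_integral \<gamma> \<epsilon>1 \<epsilon>2 (R \<xi>) \<rho>p)"

text \<open>
  \<open>b = c\<close> is allowed: for a constant state with density \<open>2 \<epsilon>1\<close> the two characteristic speeds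
  coincide and the intermediate part shrinks to a point.
\<close>

definition intermediate_constant_state ::
    "real \<Rightarrow> real \<Rightarrow> real \<Rightarrow> real \<Rightarrow> real \<Rightarrow> (real \<Rightarrow> real) \<Rightarrow> (real \<Rightarrow> real) \<Rightarrow> bool" where
  "intermediate_constant_state \<epsilon>1 \<rho>m \<rho>p b c R U \<longleftrightarrow>
     b \<le> c \<and>
     (\<exists>\<rho>s us. 2 * \<epsilon>1 \<le> \<rho>s \<and> \<rho>s < min \<rho>m \<rho>p \<and> (\<forall>\<xi>\<in>{b..c}. R \<xi> = \<rho>s \<and> U \<xi> = us))"

definition constant_density_solution ::
    "real \<Rightarrow> real \<Rightarrow> real \<Rightarrow> (real \<Rightarrow> real) \<Rightarrow> (real \<Rightarrow> real) \<Rightarrow> bool" where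
  "constant_density_solution \<epsilon>1 b c R U \<longleftrightarrow>
     b < c \<and> (\<forall>\<xi>\<in>{b..c}. R \<xi> = 2 * \<epsilon>1 \<and> U \<xi> = \<xi>)"

text \<open>
  The backward wave occupies \<open>{a..b}\<close>, the intermediate part \<open>{b..c}\<close>, the forward wave \<open>{c..d}\<close>.
  The adjacent pieces share their end points, so that each wave joins its neighbours; in particular,
  both waves extend to the density \<open>2 \<epsilon>1\<close> when the intermediate part is a constant density solution.
\<close>

definition two_rarefaction_solution ::
    "real \<Rightarrow> real \<Rightarrow> real \<Rightarrow> real \<Rightarrow> real \<Rightarrow> real \<Rightarrow> real \<Rightarrow> real \<Rightarrow> real \<Rightarrow> real \<Rightarrow> real \<Rightarrow>
     (real \<Rightarrow> real) \<Rightarrow> (real \<Rightarrow> real) \<Rightarrow> bool" where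
  "two_rarefaction_solution \<gamma> \<epsilon>1 \<epsilon>2 \<rho>m um \<rho>p up a b c d R U \<longleftrightarrow>
     self_similar_solution (perturbed_mass_flux \<epsilon>1) (perturbed_momentum_flux \<gamma> \<epsilon>1 \<epsilon>2) \<rho>m um \<rho>p up R U \<and>
     continuous_on UNIV R \<and> continuous_on UNIV U \<and>
     (\<forall>\<xi>. 2 * \<epsilon>1 \<le> R \<xi>) \<and>
     a < b \<and> c < d \<and>
     (\<forall>\<xi>\<le>a. R \<xi> = \<rho>m \<and> U \<xi> = um) \<and>
     backward_rarefaction \<gamma> \<epsilon>1 \<epsilon>2 \<rho>m um a b R U \<and>
     (intermediate_constant_state \<epsilon>1 \<rho>m \<rho>p b c R U \<or> constant_density_solution \<epsilon>1 b c R U) \<and>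
     forward_rarefaction \<gamma> \<epsilon>1 \<epsilon>2 \<rho>p up c d R U \<and>
     (\<forall>\<xi>\<ge>d. R \<xi> = \<rho>p \<and> U \<xi> = up)"

definition vacuum_density :: "real \<Rightarrow> real \<Rightarrow> real \<Rightarrow> real \<Rightarrow> real \<Rightarrow> real" where
  "vacuum_density \<rho>m um \<rho>p up \<xi> = (if \<xi> < um then \<rho>m else if \<xi> \<le> up then 0 else \<rho>p)"

definition vacuum_velocity :: "real \<Rightarrow> real \<Rightarrow> real \<Rightarrow> real" where
  "vacuum_velocity um up \<xi> = (if \<xi> < um then um else if \<xi> \<le> up then \<xi> else up)"

text \<open>
  A jump of \<open>(R, U)\<close> at \<open>\<xi> = s\<close> from \<open>(\<rho>l, ul)\<close> to \<open>(\<rho>r, ur)\<close> that satisfies the Rankine--Hugoniot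
  conditions of the zero-pressure system and travels at the characteristic speed of both adjacent
  states (the only eigenvalue of the zero-pressure system is \<open>u\<close>).
\<close>

definition zero_pressure_contact ::
    "real \<Rightarrow> real \<Rightarrow> real \<Rightarrow> real \<Rightarrow> real \<Rightarrow> (real \<Rightarrow> real) \<Rightarrow> (real \<Rightarrow> real) \<Rightarrow> bool" where
  "zero_pressure_contact s \<rho>l ul \<rho>r ur R U \<longleftrightarrow>
     (R \<longlongrightarrow> \<rho>l) (at_left s) \<and> (U \<longlongrightarrow> ul) (at_left s) \<and>
     (R \<longlongrightarrow> \<rho>r) (at_right s) \<and> (U \<longlongrightarrow> ur) (at_right s) \<and>
     (\<rho>l, ul) \<noteq> (\<rho>r, ur) \<and>
     s * (\<rho>r - \<rho>l) = zero_pressure_mass_flux \<rho>r ur - zero_pressure_mass_flux \<rho>l ul \<and>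
     s * (\<rho>r * ur - \<rho>l * ul) = zero_pressure_momentum_flux \<rho>r ur - zero_pressure_momentum_flux \<rho>l ul \<and>
     ul = s \<and> ur = s"

end

theory Submission
  imports Defs
begin

text \<open>
  Along the backward wave the density lies between \<open>2 * \<epsilon>1\<close> and \<open>\<rho>m\<close>. Two quantities control the
  wave: the change of velocity, given by the wave integral, and the distance between the velocity and the
  characteristic speed \<open>\<xi>\<close>. Both are at most a constant times \<open>sqrt (\<epsilon>2 * \<rho>m powr (\<gamma> - 1))\<close>, with a
  constant that depends on \<open>\<gamma>\<close> only (\<open>abs_wave_integral_le\<close>, \<open>char_speed_gap_le\<close>). The delicate point
  is the uniformity in \<open>\<epsilon>1\<close>, because the integrand is singular at the moving end point \<open>2 * \<epsilon>1\<close>;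
  the condition \<open>\<gamma> > 1\<close> makes the singularity integrable even in the limit \<open>\<epsilon>1 = 0\<close>. The forward wave
  is treated alike.

  Hence each wave, together with its velocities, stays within a distance of order \<open>sqrt \<epsilon>2\<close> from \<open>um\<close> or
  \<open>up\<close> (\<open>two_rarefaction_estimates\<close>). This gives everything that concerns the perturbed system. A
  constant intermediate state would force the velocities at the inner ends of the waves to agree, which is
  impossible when they are near the different numbers \<open>um\<close> and \<open>up\<close>; so the intermediate part is the
  constant density solution. The edges \<open>a\<close>, \<open>b\<close> tend to \<open>um\<close> and \<open>c\<close>, \<open>d\<close> to \<open>up\<close>. Any \<open>\<xi>\<close> other than
  \<open>um\<close>, \<open>up\<close> eventually lies in one of the two constant states or in the constant density solution, where the values
  are \<open>(2 * \<epsilon>1, \<xi>)\<close>.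

  That the limit solves the zero-pressure system needs no limit passage. The left state moves
  with velocity \<open>um\<close> behind the line \<open>x = um * t\<close>, the right one with velocity \<open>up\<close> ahead of \<open>x = up * t\<close>,
  and between them all densities and fluxes vanish. So mass and momentum are sums of two solutions
  \<open>p (x - v * t)\<close> of linear transport equations (\<open>transport_weak_solution\<close>).
\<close>

section \<open>The extent of a rarefaction wave\<close>

text \<open>
  The bound has to be uniform in \<open>\<epsilon>1\<close>. Estimating \<open>s powr (\<gamma> - 2)\<close> by its largest value fails for
  \<open>\<gamma> < 2\<close>, where it blows up with \<open>s \<rightarrow> 0\<close>. With \<open>\<beta> = min \<gamma> 2\<close> the factor \<open>s powr (\<gamma> - \<beta>)\<close> is
  nondecreasing in \<open>s\<close>, and \<open>s powr (\<beta> - 2)\<close> is nonincreasing, so that \<open>s\<close> may be replaced there by the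
  smaller number \<open>s - 2 * \<epsilon>1\<close>. Since \<open>\<beta> > 1\<close> for \<open>\<gamma> > 1\<close>, the remaining singularity is integrable.
\<close>

lemma wave_integrand_le:
  fixes \<gamma> \<epsilon>1 \<epsilon>2 \<rho> s :: real
  assumes "0 < \<epsilon>1" "0 < \<epsilon>2" "2 * \<epsilon>1 < s" "s \<le> \<rho>"
  shows "sqrt (\<epsilon>2 * s powr (\<gamma> - 2) / (s - 2 * \<epsilon>1))
    \<le> sqrt (\<epsilon>2 * \<rho> powr (\<gamma> - min \<gamma> 2)) * (s - 2 * \<epsilon>1) powr ((min \<gamma> 2 - 1) / 2 - 1)"
proof -
  define \<beta> where "\<beta> = min \<gamma> 2"
  define y where "y = s - 2 * \<epsilon>1"
  have y: "0 < y" "y \<le> s" "0 < s" using assms by (auto simp: y_def)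
  have "s powr (\<gamma> - 2) = s powr (\<gamma> - \<beta>) * s powr (\<beta> - 2)"
    by (simp flip: powr_add)
  also have "\<dots> \<le> \<rho> powr (\<gamma> - \<beta>) * y powr (\<beta> - 2)"
    using y assms by (intro mult_mono powr_mono2 powr_mono2') (auto simp: \<beta>_def)
  finally have "s powr (\<gamma> - 2) / y \<le> \<rho> powr (\<gamma> - \<beta>) * y powr (\<beta> - 2) / y"
    using y by (simp add: divide_right_mono)
  also have "\<dots> = \<rho> powr (\<gamma> - \<beta>) * y powr (\<beta> - 3)"
    using y powr_add[of y "\<beta> - 3" 1] by (simp add: field_simps)
  finally have "sqrt (\<epsilon>2 * (s powr (\<gamma> - 2) / y)) \<le> sqrt (\<epsilon>2 * (\<rho> powr (\<gamma> - \<beta>) * y powr (\<beta> - 3)))"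
    using assms by (intro real_sqrt_le_mono mult_left_mono) auto
  also have "\<dots> = sqrt (\<epsilon>2 * \<rho> powr (\<gamma> - \<beta>)) * sqrt (y powr (\<beta> - 3))"
    by (simp add: real_sqrt_mult)
  also have "sqrt (y powr (\<beta> - 3)) = y powr ((\<beta> - 1) / 2 - 1)"
    using y by (simp add: powr_half_sqrt[symmetric] powr_powr field_simps)
  finally show ?thesis by (simp add: \<beta>_def y_def)
qed

lemma powr_interval_integral_shifted:
  fixes e \<rho> q :: real
  assumes "e < \<rho>" "0 < q"
  shows "set_integrable lborel {e<..<\<rho>} (\<lambda>s. (s - e) powr (q - 1))"
    and "(LINT s:{e<..<\<rho>}|lborel. (s - e) powr (q - 1)) = (\<rho> - e) powr q / q"
proof -
  let ?F = "\<lambda>s. (s - e) powr q / q"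
  have cont: "(?F \<longlongrightarrow> (x - e) powr q / q) (at x within A)" if "e \<le> x" "\<And>y. y \<in> A \<Longrightarrow> e \<le> y" for x A
    using assms that
    by (intro tendsto_divide tendsto_powr' tendsto_diff tendsto_ident_at tendsto_const)
       (auto simp: eventually_at_topological)
  have A: "((?F \<circ> real_of_ereal) \<longlongrightarrow> 0) (at_right (ereal e))"
    unfolding ereal_tendsto_simps using cont[of e "{e<..}"] assms by simp
  have B: "((?F \<circ> real_of_ereal) \<longlongrightarrow> (\<rho> - e) powr q / q) (at_left (ereal \<rho>))"
  proof -
    have "(?F \<longlongrightarrow> (\<rho> - e) powr q / q) (at_left \<rho>)"
      using assms by (intro tendsto_intros) auto
    then show ?thesis unfolding ereal_tendsto_simps .
  qed
  have D: "DERIV ?F x :> (x - e) powr (q - 1)" if "ereal e < ereal x" for x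
    using that assms by (auto intro!: derivative_eq_intros)
  have C: "isCont (\<lambda>s. (s - e) powr (q - 1)) x" if "ereal e < ereal x" for x
    using that by (intro continuous_intros) auto
  note FTC = interval_integral_FTC_nonneg[of "ereal e" "ereal \<rho>" ?F, OF _ D C _ A B]
  show "set_integrable lborel {e<..<\<rho>} (\<lambda>s. (s - e) powr (q - 1))"
    using FTC(1) assms by simp
  show "(LINT s:{e<..<\<rho>}|lborel. (s - e) powr (q - 1)) = (\<rho> - e) powr q / q"
    using FTC(2) assms by (simp add: interval_lebesgue_integral_def)
qed

lemma wave_integral_reverse:
  "wave_integral \<gamma> \<epsilon>1 \<epsilon>2 \<rho> r = - wave_integral \<gamma> \<epsilon>1 \<epsilon>2 r \<rho>"
  unfolding wave_integral_def by (rule interval_integral_endpoints_reverse)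

text \<open>
  The bound does not depend on \<open>\<epsilon>1\<close>: the primitive of the majorant in \<open>wave_integrand_le\<close> vanishes at
  the singular end point, and its value at \<open>\<rho>\<close> grows when \<open>2 * \<epsilon>1\<close> is dropped.
\<close>

lemma abs_wave_integral_le:
  fixes \<gamma> \<epsilon>1 \<epsilon>2 \<rho> r :: real
  assumes "1 < \<gamma>" "0 < \<epsilon>1" "0 < \<epsilon>2" "2 * \<epsilon>1 \<le> r" "r \<le> \<rho>"
  shows "\<bar>wave_integral \<gamma> \<epsilon>1 \<epsilon>2 r \<rho>\<bar> \<le> 2 / (min \<gamma> 2 - 1) * sqrt (\<epsilon>2 * \<rho> powr (\<gamma> - 1))"
proof (cases "r = \<rho>")
  case True
  then show ?thesis using assms by (simp add: wave_integral_def)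
next
  case False
  define q where "q = (min \<gamma> 2 - 1) / 2"
  define K where "K = sqrt (\<epsilon>2 * \<rho> powr (\<gamma> - min \<gamma> 2))"
  let ?f = "\<lambda>s. sqrt (\<epsilon>2 * s powr (\<gamma> - 2) / (s - 2 * \<epsilon>1))"
  let ?g = "\<lambda>s. K * (s - 2 * \<epsilon>1) powr (q - 1)"
  have q: "0 < q" and \<rho>: "2 * \<epsilon>1 < \<rho>" "0 < \<rho>" and K: "0 \<le> K"
    using assms False by (auto simp: q_def K_def)
  note powr = powr_interval_integral_shifted[OF \<rho>(1) q]
  have eq: "wave_integral \<gamma> \<epsilon>1 \<epsilon>2 r \<rho> = (LINT s:{r<..<\<rho>}|lborel. ?f s)"
    using assms by (simp add: wave_integral_def interval_lebesgue_integral_def)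
  have nonneg: "0 \<le> (LINT s:{r<..<\<rho>}|lborel. ?f s)"
    unfolding set_lebesgue_integral_def using assms
    by (intro Bochner_Integration.integral_nonneg) (auto simp: indicator_def)
  have "(LINT s:{r<..<\<rho>}|lborel. ?f s) \<le> (LINT s:{2 * \<epsilon>1<..<\<rho>}|lborel. ?g s)"
    unfolding set_lebesgue_integral_def
  proof (rule integral_mono')
    show "integrable lborel (\<lambda>s. indicator {2 * \<epsilon>1<..<\<rho>} s *\<^sub>R ?g s)"
      using set_integrable_mult_right[OF powr(1), of K] by (simp add: set_integrable_def)
    show "indicator {r<..<\<rho>} s *\<^sub>R ?f s \<le> indicator {2 * \<epsilon>1<..<\<rho>} s *\<^sub>R ?g s" for s
      using assms wave_integrand_le[of \<epsilon>1 \<epsilon>2 s \<rho> \<gamma>] K by (auto simp: indicator_def q_def K_def)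
    show "0 \<le> indicator {2 * \<epsilon>1<..<\<rho>} s *\<^sub>R ?g s" for s
      using K by (auto simp: indicator_def)
  qed
  also have "\<dots> = K * ((\<rho> - 2 * \<epsilon>1) powr q / q)"
    using powr(2) by simp
  also have "\<dots> \<le> K * (\<rho> powr q / q)"
    using K q assms \<rho> by (intro mult_left_mono divide_right_mono powr_mono2) auto
  also have "\<dots> = 2 / (min \<gamma> 2 - 1) * sqrt (\<epsilon>2 * \<rho> powr (\<gamma> - 1))"
  proof -
    have "\<rho> powr q = sqrt (\<rho> powr (min \<gamma> 2 - 1))"
      using \<rho> by (simp add: powr_half_sqrt[symmetric] powr_powr q_def)
    then have "K * \<rho> powr q = sqrt (\<epsilon>2 * (\<rho> powr (\<gamma> - min \<gamma> 2) * \<rho> powr (min \<gamma> 2 - 1)))"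
      by (simp add: K_def real_sqrt_mult)
    also have "\<rho> powr (\<gamma> - min \<gamma> 2) * \<rho> powr (min \<gamma> 2 - 1) = \<rho> powr (\<gamma> - 1)"
      by (simp flip: powr_add)
    finally show ?thesis using q by (simp add: q_def field_simps)
  qed
  finally show ?thesis using eq nonneg by simp
qed

lemma char_speed_gap_le:
  fixes \<gamma> \<epsilon>1 \<epsilon>2 \<rho> r :: real
  assumes "1 < \<gamma>" "0 < \<epsilon>1" "0 < \<epsilon>2" "2 * \<epsilon>1 \<le> r" "r \<le> \<rho>"
  shows "sqrt (\<epsilon>2 * r powr (\<gamma> - 2) * (r - 2 * \<epsilon>1)) \<le> sqrt (\<epsilon>2 * \<rho> powr (\<gamma> - 1))"
proof -
  have "r powr (\<gamma> - 2) * (r - 2 * \<epsilon>1) \<le> r powr (\<gamma> - 2) * r"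
    using assms by (intro mult_left_mono) auto
  also have "\<dots> = r powr (\<gamma> - 1)"
    using assms powr_add[of r "\<gamma> - 2" 1] by simp
  also have "\<dots> \<le> \<rho> powr (\<gamma> - 1)"
    using assms by (intro powr_mono2) auto
  finally show ?thesis using assms by (simp add: mult.assoc)
qed

text \<open>
  In the first factor, 1 accounts for the distance between the characteristic speed and the velocity,
  the other summand for the change of velocity across a wave whose outer density is \<open>\<rho>\<close>.
\<close>

definition wave_width :: "real \<Rightarrow> real \<Rightarrow> real \<Rightarrow> real" where
  "wave_width \<gamma> \<epsilon>2 \<rho> = (1 + 2 / (min \<gamma> 2 - 1)) * sqrt (\<epsilon>2 * \<rho> powr (\<gamma> - 1))"

text \<open>
  Common to both families: \<open>v\<close> is the velocity in the wave where the density is \<open>r\<close>, and \<open>\<xi>\<close> is the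
  characteristic speed of that state; \<open>(\<rho>, u)\<close> is the outer state. The sign that distinguishes the two
  families disappears under the absolute values.
\<close>

lemma rarefaction_state_close:
  fixes \<gamma> \<epsilon>1 \<epsilon>2 \<rho> r u v \<xi> :: real
  assumes "1 < \<gamma>" "0 < \<epsilon>1" "0 < \<epsilon>2" "2 * \<epsilon>1 \<le> r" "r \<le> \<rho>"
    and "\<bar>v - u\<bar> = \<bar>wave_integral \<gamma> \<epsilon>1 \<epsilon>2 r \<rho>\<bar>"
    and "\<bar>\<xi> - v\<bar> = sqrt (\<epsilon>2 * r powr (\<gamma> - 2) * (r - 2 * \<epsilon>1))"
  shows "\<bar>v - u\<bar> \<le> wave_width \<gamma> \<epsilon>2 \<rho>" "\<bar>\<xi> - u\<bar> \<le> wave_width \<gamma> \<epsilon>2 \<rho>"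
proof -
  have 1: "\<bar>v - u\<bar> \<le> 2 / (min \<gamma> 2 - 1) * sqrt (\<epsilon>2 * \<rho> powr (\<gamma> - 1))"
    using abs_wave_integral_le[OF assms(1-5)] assms(6) by simp
  have 2: "\<bar>\<xi> - v\<bar> \<le> sqrt (\<epsilon>2 * \<rho> powr (\<gamma> - 1))"
    using char_speed_gap_le[OF assms(1-5)] assms(7) by simp
  show "\<bar>v - u\<bar> \<le> wave_width \<gamma> \<epsilon>2 \<rho>" "\<bar>\<xi> - u\<bar> \<le> wave_width \<gamma> \<epsilon>2 \<rho>"
    using 1 2 by (simp_all add: wave_width_def algebra_simps)
qed

lemma backward_rarefaction_close:
  assumes "1 < \<gamma>" "0 < \<epsilon>1" "0 < \<epsilon>2" "\<And>\<xi>. 2 * \<epsilon>1 \<le> R \<xi>"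
    and wave: "backward_rarefaction \<gamma> \<epsilon>1 \<epsilon>2 \<rho>m um a b R U" and "R a = \<rho>m" "\<xi> \<in> {a..b}"
  shows "\<bar>U \<xi> - um\<bar> \<le> wave_width \<gamma> \<epsilon>2 \<rho>m" "\<bar>\<xi> - um\<bar> \<le> wave_width \<gamma> \<epsilon>2 \<rho>m"
proof -
  have *: "strict_antimono_on {a..b} R" "\<xi> = char_speed1 \<gamma> \<epsilon>1 \<epsilon>2 (R \<xi>) (U \<xi>)"
    "U \<xi> - um = - wave_integral \<gamma> \<epsilon>1 \<epsilon>2 \<rho>m (R \<xi>)"
    using wave assms(7) by (auto simp: backward_rarefaction_def)
  have "R \<xi> \<le> \<rho>m"
    using monotone_onD[OF *(1), of a \<xi>] assms(6,7) by (cases "\<xi> = a") auto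
  moreover have "\<bar>U \<xi> - um\<bar> = \<bar>wave_integral \<gamma> \<epsilon>1 \<epsilon>2 (R \<xi>) \<rho>m\<bar>"
    using *(3) wave_integral_reverse[of \<gamma> \<epsilon>1 \<epsilon>2 \<rho>m "R \<xi>"] by simp
  moreover have gap: "0 \<le> sqrt (\<epsilon>2 * R \<xi> powr (\<gamma> - 2) * (R \<xi> - 2 * \<epsilon>1))"
    using assms(3) assms(4)[of \<xi>] by simp
  moreover have "\<bar>\<xi> - U \<xi>\<bar> = sqrt (\<epsilon>2 * R \<xi> powr (\<gamma> - 2) * (R \<xi> - 2 * \<epsilon>1))"
    using *(2) gap unfolding char_speed1_def by linarith
  ultimately show "\<bar>U \<xi> - um\<bar> \<le> wave_width \<gamma> \<epsilon>2 \<rho>m" "\<bar>\<xi> - um\<bar> \<le> wave_width \<gamma> \<epsilon>2 \<rho>m"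
    using rarefaction_state_close[of \<gamma> \<epsilon>1 \<epsilon>2 "R \<xi>" \<rho>m "U \<xi>" um \<xi>] assms(1-4) by auto
qed

lemma forward_rarefaction_close:
  assumes "1 < \<gamma>" "0 < \<epsilon>1" "0 < \<epsilon>2" "\<And>\<xi>. 2 * \<epsilon>1 \<le> R \<xi>"
    and wave: "forward_rarefaction \<gamma> \<epsilon>1 \<epsilon>2 \<rho>p up c d R U" and "R d = \<rho>p" "\<xi> \<in> {c..d}"
  shows "\<bar>U \<xi> - up\<bar> \<le> wave_width \<gamma> \<epsilon>2 \<rho>p" "\<bar>\<xi> - up\<bar> \<le> wave_width \<gamma> \<epsilon>2 \<rho>p"
proof -
  have *: "strict_mono_on {c..d} R" "\<xi> = char_speed2 \<gamma> \<epsilon>1 \<epsilon>2 (R \<xi>) (U \<xi>)"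
    "up - U \<xi> = wave_integral \<gamma> \<epsilon>1 \<epsilon>2 (R \<xi>) \<rho>p"
    using wave assms(7) by (auto simp: forward_rarefaction_def)
  have "R \<xi> \<le> \<rho>p"
    using monotone_onD[OF *(1), of \<xi> d] assms(6,7) by (cases "\<xi> = d") auto
  moreover have "\<bar>U \<xi> - up\<bar> = \<bar>wave_integral \<gamma> \<epsilon>1 \<epsilon>2 (R \<xi>) \<rho>p\<bar>"
    using *(3) by simp
  moreover have gap: "0 \<le> sqrt (\<epsilon>2 * R \<xi> powr (\<gamma> - 2) * (R \<xi> - 2 * \<epsilon>1))"
    using assms(3) assms(4)[of \<xi>] by simp
  moreover have "\<bar>\<xi> - U \<xi>\<bar> = sqrt (\<epsilon>2 * R \<xi> powr (\<gamma> - 2) * (R \<xi> - 2 * \<epsilon>1))"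
    using *(2) gap unfolding char_speed2_def by linarith
  ultimately show "\<bar>U \<xi> - up\<bar> \<le> wave_width \<gamma> \<epsilon>2 \<rho>p" "\<bar>\<xi> - up\<bar> \<le> wave_width \<gamma> \<epsilon>2 \<rho>p"
    using rarefaction_state_close[of \<gamma> \<epsilon>1 \<epsilon>2 "R \<xi>" \<rho>p "U \<xi>" up \<xi>] assms(1-4) by auto
qed

text \<open>
  A constant intermediate state would carry one and the same velocity to the inner ends of the two waves,
  although these velocities are close to \<open>um\<close> and to \<open>up\<close>. This is what excludes it for small
  pressure, whatever the size of \<open>\<epsilon>1\<close>.
\<close>

lemma two_rarefaction_estimates:
  assumes "1 < \<gamma>" "0 < \<epsilon>1" "0 < \<epsilon>2"
    and sol: "two_rarefaction_solution \<gamma> \<epsilon>1 \<epsilon>2 \<rho>m um \<rho>p up a b c d R U"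
  shows "\<bar>a - um\<bar> \<le> wave_width \<gamma> \<epsilon>2 \<rho>m" "\<bar>b - um\<bar> \<le> wave_width \<gamma> \<epsilon>2 \<rho>m"
    and "\<bar>c - up\<bar> \<le> wave_width \<gamma> \<epsilon>2 \<rho>p" "\<bar>d - up\<bar> \<le> wave_width \<gamma> \<epsilon>2 \<rho>p"
    and "wave_width \<gamma> \<epsilon>2 \<rho>m + wave_width \<gamma> \<epsilon>2 \<rho>p < up - um \<Longrightarrow> constant_density_solution \<epsilon>1 b c R U"
proof -
  have R: "\<And>\<xi>. 2 * \<epsilon>1 \<le> R \<xi>" and bw: "backward_rarefaction \<gamma> \<epsilon>1 \<epsilon>2 \<rho>m um a b R U" "R a = \<rho>m"
    and fw: "forward_rarefaction \<gamma> \<epsilon>1 \<epsilon>2 \<rho>p up c d R U" "R d = \<rho>p" and ord: "a < b" "c < d"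
    and mid: "intermediate_constant_state \<epsilon>1 \<rho>m \<rho>p b c R U \<or> constant_density_solution \<epsilon>1 b c R U"
    using sol by (auto simp: two_rarefaction_solution_def)
  note b = backward_rarefaction_close[OF assms(1-3) R bw]
  note f = forward_rarefaction_close[OF assms(1-3) R fw]
  show "\<bar>a - um\<bar> \<le> wave_width \<gamma> \<epsilon>2 \<rho>m" "\<bar>b - um\<bar> \<le> wave_width \<gamma> \<epsilon>2 \<rho>m"
    using b(2) ord by auto
  show "\<bar>c - up\<bar> \<le> wave_width \<gamma> \<epsilon>2 \<rho>p" "\<bar>d - up\<bar> \<le> wave_width \<gamma> \<epsilon>2 \<rho>p"
    using f(2) ord by auto
  assume small: "wave_width \<gamma> \<epsilon>2 \<rho>m + wave_width \<gamma> \<epsilon>2 \<rho>p < up - um"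
  have "\<not> intermediate_constant_state \<epsilon>1 \<rho>m \<rho>p b c R U"
  proof
    assume "intermediate_constant_state \<epsilon>1 \<rho>m \<rho>p b c R U"
    then have "U b = U c" by (auto simp: intermediate_constant_state_def)
    moreover have "\<bar>U b - um\<bar> \<le> wave_width \<gamma> \<epsilon>2 \<rho>m" "\<bar>U c - up\<bar> \<le> wave_width \<gamma> \<epsilon>2 \<rho>p"
      using b(1)[of b] f(1)[of c] ord by auto
    ultimately show False using small by linarith
  qed
  with mid show "constant_density_solution \<epsilon>1 b c R U" by simp
qed


section \<open>The linear transport equation\<close>

lemma test_function_deriv_outside:
  assumes "test_function \<phi> \<phi>t \<phi>x" "closed K" "\<And>z. z \<notin> K \<Longrightarrow> \<phi> z = 0" "z \<notin> K"
  shows "\<phi>t z = 0" "\<phi>x z = 0"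
proof -
  have "(\<phi> has_derivative (\<lambda>(h, k). \<phi>t z * h + \<phi>x z * k)) (at z)"
    using assms(1) unfolding test_function_def by blast
  moreover have "(\<phi> has_derivative (\<lambda>_. 0)) (at z)"
  proof (rule has_derivative_transform_within_open[OF has_derivative_const[of 0]])
    show "open (- K)" using assms(2) by (simp add: open_Compl)
  qed (use assms(3,4) in auto)
  ultimately have "(\<lambda>(h, k). \<phi>t z * h + \<phi>x z * k) = (\<lambda>_. 0)"
    by (rule has_derivative_unique)
  from fun_cong[OF this, of "(1, 0)"] fun_cong[OF this, of "(0, 1)"]
  show "\<phi>t z = 0" "\<phi>x z = 0" by simp_all
qed

lemma test_function_continuous:
  assumes "test_function \<phi> \<phi>t \<phi>x"
  shows "continuous_on UNIV \<phi>"
  using assms unfolding test_function_def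
  by (meson has_derivative_continuous continuous_at_imp_continuous_on)

lemma test_function_initial_continuous:
  assumes "test_function \<phi> \<phi>t \<phi>x"
  shows "continuous_on UNIV (\<lambda>x. \<phi> (0, x))"
proof (rule continuous_on_compose2[OF test_function_continuous[OF assms]])
  show "continuous_on UNIV (\<lambda>x::real. (0::real, x))"
    by (rule continuous_on_Pair[OF continuous_on_const continuous_on_id])
qed simp

lemma integrable_bounded_mult_compact_support:
  fixes q h :: "'a::euclidean_space \<Rightarrow> real"
  assumes "q \<in> borel_measurable borel" "\<And>z. \<bar>q z\<bar> \<le> B"
    and "continuous_on UNIV h" "compact K" "\<And>z. z \<notin> K \<Longrightarrow> h z = 0"
  shows "integrable lborel (\<lambda>z. q z * h z)"
proof -
  have "integrable lborel (\<lambda>z. indicator K z *\<^sub>R h z)"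
    using assms by (intro borel_integrable_compact continuous_on_subset[OF assms(3)]) auto
  moreover have "indicator K z *\<^sub>R h z = h z" for z
    using assms(5) by (auto simp: indicator_def)
  ultimately have h: "integrable lborel h" by (simp only:)
  show ?thesis
  proof (rule Bochner_Integration.integrable_bound)
    show "integrable lborel (\<lambda>z. B * h z)" using h by simp
    show "(\<lambda>z. q z * h z) \<in> borel_measurable lborel"
      using assms(1) h by measurable
    have "norm (q z * h z) \<le> norm (B * h z)" for z
      using order_trans[OF assms(2)[of z] abs_ge_self] by (simp add: abs_mult mult_right_mono)
    then show "AE z in lborel. norm (q z * h z) \<le> norm (B * h z)" by simp
  qed
qed

lemma integral_derivative_half_line:
  fixes \<psi> \<psi>' :: "real \<Rightarrow> real"
  assumes "\<And>t. (\<psi> has_real_derivative \<psi>' t) (at t)" "continuous_on UNIV \<psi>'"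
    and "0 \<le> T" "\<And>t. T \<le> t \<Longrightarrow> \<psi> t = 0" "\<And>t. T \<le> t \<Longrightarrow> \<psi>' t = 0"
  shows "(LINT t:{0<..}|lborel. \<psi>' t) = - \<psi> 0"
proof -
  have "(LINT t:{0<..}|lborel. \<psi>' t) = (LINT t:{0<..<T}|lborel. \<psi>' t)"
    unfolding set_lebesgue_integral_def using assms(5)
    by (intro Bochner_Integration.integral_cong) (auto simp: indicator_def not_less)
  also have "\<dots> = (LBINT t=ereal 0..ereal T. \<psi>' t)"
    using assms(3) by (simp add: interval_lebesgue_integral_def)
  also have "\<dots> = \<psi> T - \<psi> 0"
    using assms(1,2)
    by (intro interval_integral_FTC_finite)
       (auto intro: continuous_on_subset has_vector_derivative_at_within
          simp: has_real_derivative_iff_has_vector_derivative)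
  finally show ?thesis using assms(4)[of T] by simp
qed

text \<open>
  The integrand is the derivative of \<open>\<phi>\<close> along the line \<open>x = y + v * t\<close>.
\<close>

lemma integral_along_characteristic:
  assumes "test_function \<phi> \<phi>t \<phi>x"
  shows "(LINT t:{0<..}|lborel. \<phi>t (t, y + v * t) + v * \<phi>x (t, y + v * t)) = - \<phi> (0, y)"
proof -
  obtain K where K: "compact K" "\<And>z. z \<notin> K \<Longrightarrow> \<phi> z = 0"
    using assms by (auto simp: test_function_def)
  obtain T where T: "0 < T" "\<And>z. z \<in> K \<Longrightarrow> norm z \<le> T"
    using compact_imp_bounded[OF K(1)] by (auto simp: bounded_pos)
  have out: "(t, x) \<notin> K" if "T + 1 \<le> t" for t x
    using T(2)[of "(t, x)"] norm_fst_le[of t x] that T(1) by force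
  have D: "((\<lambda>t. \<phi> (t, y + v * t)) has_real_derivative \<phi>t (t, y + v * t) + v * \<phi>x (t, y + v * t)) (at t)" for t
  proof -
    have "(\<phi> has_derivative (\<lambda>(h, k). \<phi>t (t, y + v * t) * h + \<phi>x (t, y + v * t) * k)) (at (t, y + v * t))"
      using assms unfolding test_function_def by blast
    moreover have "((\<lambda>t. (t, y + v * t)) has_derivative (\<lambda>h. (h, v * h))) (at t)"
      by (auto intro!: derivative_eq_intros)
    ultimately have "((\<lambda>t. \<phi> (t, y + v * t)) has_derivative
        (\<lambda>h. case (h, v * h) of (h, k) \<Rightarrow> \<phi>t (t, y + v * t) * h + \<phi>x (t, y + v * t) * k)) (at t)"
      by (rule has_derivative_compose[rotated])
    moreover have "(\<lambda>h. case (h, v * h) of (h, k) \<Rightarrow> \<phi>t (t, y + v * t) * h + \<phi>x (t, y + v * t) * k)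
        = (*) (\<phi>t (t, y + v * t) + v * \<phi>x (t, y + v * t))"
      by (auto simp: algebra_simps)
    ultimately show ?thesis
      by (simp only: has_field_derivative_def)
  qed
  have C: "continuous_on UNIV (\<lambda>t. \<phi>t (t, y + v * t) + v * \<phi>x (t, y + v * t))"
    using assms unfolding test_function_def
    by (auto intro!: continuous_intros continuous_on_compose2[of UNIV \<phi>t] continuous_on_compose2[of UNIV \<phi>x])
  show ?thesis
    using integral_derivative_half_line[OF D C, of "T + 1"] T(1) K(2)[OF out]
      test_function_deriv_outside[OF assms compact_imp_closed[OF K(1)] K(2) out]
    by simp
qed

text \<open>
  The shear \<open>x = y + v * t\<close> turns \<open>p (x - v * t)\<close> into \<open>p y\<close>, which comes out of the integral over \<open>t\<close>;
  what is left is the integral along the characteristic that starts at \<open>y\<close>. The profile is never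
  differentiated, so that this covers travelling jumps.
\<close>

lemma transport_weak_solution:
  fixes p :: "real \<Rightarrow> real" and v :: real
  assumes p: "p \<in> borel_measurable borel" "\<And>y. \<bar>p y\<bar> \<le> B"
  shows "weak_conservation_law (\<lambda>(t, x). p (x - v * t)) (\<lambda>(t, x). v * p (x - v * t)) p"
  unfolding weak_conservation_law_def
proof (intro allI impI)
  fix \<phi> \<phi>t \<phi>x :: "real \<times> real \<Rightarrow> real"
  assume \<phi>: "test_function \<phi> \<phi>t \<phi>x"
  obtain K where K: "compact K" "\<And>z. z \<notin> K \<Longrightarrow> \<phi> z = 0"
    using \<phi> by (auto simp: test_function_def)
  note [measurable] = p(1)
  define g where "g = (\<lambda>z. \<phi>t z + v * \<phi>x z)"
  have g: "continuous_on UNIV g"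
    using \<phi> by (auto simp: g_def test_function_def intro!: continuous_intros)
  have g0: "g z = 0" if "z \<notin> K" for z
    using test_function_deriv_outside[OF \<phi> compact_imp_closed[OF K(1)] K(2) that] by (simp add: g_def)
  \<comment> \<open>\<open>?S\<close> is the shear and \<open>?q'\<close> is \<open>?q\<close> in the sheared coordinates; the support of
    the test function is sheared to a compact set as well.\<close>
  let ?q = "\<lambda>z::real \<times> real. indicator {0<..} (fst z) * p (snd z - v * fst z)"
  let ?q' = "\<lambda>z::real \<times> real. indicator {0<..} (fst z) * p (snd z)"
  let ?S = "\<lambda>z::real \<times> real. (fst z, snd z + v * fst z)"
  have B: "0 \<le> B" using p(2)[of 0] by simp
  have meas: "?q \<in> borel_measurable borel" "?q' \<in> borel_measurable borel"
    unfolding borel_prod[symmetric] by measurable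
  have int: "integrable lborel (\<lambda>z. ?q z * g z)"
    using p(2) B
    by (intro integrable_bounded_mult_compact_support[where B = B and K = K] g K(1) g0 meas)
       (auto simp: indicator_def)
  have int': "integrable lborel (\<lambda>z. ?q' z * g (?S z))"
  proof (rule integrable_bounded_mult_compact_support[where B = B
        and K = "(\<lambda>z. (fst z, snd z - v * fst z)) ` K"])
    show "continuous_on UNIV (\<lambda>z. g (?S z))"
      by (auto intro!: continuous_on_compose2[OF g] continuous_intros)
    show "compact ((\<lambda>z. (fst z, snd z - v * fst z)) ` K)"
      by (intro compact_continuous_image K continuous_intros)
    show "g (?S z) = 0" if "z \<notin> (\<lambda>z. (fst z, snd z - v * fst z)) ` K" for z
      using that by (intro g0) force
  qed (use meas p(2) B in \<open>auto simp: indicator_def\<close>)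
  have eq: "indicator ({0<..} \<times> UNIV) z *\<^sub>R
      ((case z of (t, x) \<Rightarrow> p (x - v * t)) * \<phi>t z + (case z of (t, x) \<Rightarrow> v * p (x - v * t)) * \<phi>x z)
      = ?q z * g z" for z :: "real \<times> real"
    by (cases z) (auto simp: indicator_def g_def algebra_simps)
  have "(LINT z|lborel. ?q z * g z) = (LINT t|lborel. LINT x|lborel. ?q (t, x) * g (t, x))"
    using lborel_pair.integral_fst'[of "\<lambda>z. ?q z * g z"] int by (simp add: lborel_prod)
  also have "\<dots> = (LINT t|lborel. LINT y|lborel. ?q' (t, y) * g (?S (t, y)))"
  proof (rule Bochner_Integration.integral_cong[OF refl])
    fix t :: real
    show "(LINT x|lborel. ?q (t, x) * g (t, x)) = (LINT y|lborel. ?q' (t, y) * g (?S (t, y)))"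
      using lborel_integral_real_affine[of 1 "\<lambda>x. ?q (t, x) * g (t, x)" "v * t"]
      by (simp add: add.commute)
  qed
  also have "\<dots> = (LINT y|lborel. LINT t|lborel. ?q' (t, y) * g (?S (t, y)))"
    using lborel_pair.Fubini_integral[of "\<lambda>t y. ?q' (t, y) * g (?S (t, y))"] int'
    by (simp add: lborel_prod case_prod_unfold)
  also have "\<dots> = (LINT y|lborel. - (p y * \<phi> (0, y)))"
  proof (rule Bochner_Integration.integral_cong[OF refl])
    fix y :: real
    have "(LINT t|lborel. ?q' (t, y) * g (?S (t, y)))
        = (LINT t|lborel. p y * (indicator {0<..} t *\<^sub>R (\<phi>t (t, y + v * t) + v * \<phi>x (t, y + v * t))))"
      by (intro Bochner_Integration.integral_cong) (auto simp: g_def indicator_def)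
    also have "\<dots> = p y * (LINT t:{0<..}|lborel. \<phi>t (t, y + v * t) + v * \<phi>x (t, y + v * t))"
      unfolding set_lebesgue_integral_def by (rule integral_mult_right_zero)
    finally show "(LINT t|lborel. ?q' (t, y) * g (?S (t, y))) = - (p y * \<phi> (0, y))"
      using integral_along_characteristic[OF \<phi>] by simp
  qed
  finally have *: "(LINT z|lborel. ?q z * g z) + (LINT y|lborel. p y * \<phi> (0, y)) = 0"
    by simp
  have int0: "integrable lborel (\<lambda>x. p x * \<phi> (0, x))"
  proof (rule integrable_bounded_mult_compact_support[OF p, where K = "snd ` K"])
    show "continuous_on UNIV (\<lambda>x. \<phi> (0, x))"
      by (rule test_function_initial_continuous[OF \<phi>])
    show "compact (snd ` K)"
      by (rule compact_continuous_image[OF continuous_on_snd[OF continuous_on_id] K(1)])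
    show "\<phi> (0, x) = 0" if "x \<notin> snd ` K" for x
      using that image_eqI[of x snd "(0, x)" K] by (intro K(2)) auto
  qed
  let ?h = "\<lambda>z. (case z of (t, x) \<Rightarrow> p (x - v * t)) * \<phi>t z + (case z of (t, x) \<Rightarrow> v * p (x - v * t)) * \<phi>x z"
  have "set_integrable lborel ({0<..} \<times> UNIV) ?h"
    unfolding set_integrable_def eq by (rule int)
  moreover have "(LINT z:{0<..} \<times> UNIV|lborel. ?h z) + (LINT x|lborel. p x * \<phi> (0, x)) = 0"
    unfolding set_lebesgue_integral_def eq by (rule *)
  ultimately show "set_integrable lborel ({0<..} \<times> UNIV) ?h \<and>
      integrable lborel (\<lambda>x. p x * \<phi> (0, x)) \<and>
      (LINT z:{0<..} \<times> UNIV|lborel. ?h z) + (LINT x|lborel. p x * \<phi> (0, x)) = 0"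
    using int0 by (intro conjI)
qed

lemma weak_conservation_law_add:
  assumes "weak_conservation_law w1 f1 p1" "weak_conservation_law w2 f2 p2"
  shows "weak_conservation_law (\<lambda>z. w1 z + w2 z) (\<lambda>z. f1 z + f2 z) (\<lambda>x. p1 x + p2 x)"
  unfolding weak_conservation_law_def
proof (intro allI impI)
  fix \<phi> \<phi>t \<phi>x :: "real \<times> real \<Rightarrow> real"
  assume \<phi>: "test_function \<phi> \<phi>t \<phi>x"
  let ?D = "{0<..} \<times> UNIV :: (real \<times> real) set"
  let ?h = "\<lambda>w f z. w z * \<phi>t z + f z * \<phi>x z"
  note law1 = assms(1)[unfolded weak_conservation_law_def, rule_format, OF \<phi>]
  note 1 = conjunct1[OF law1] conjunct1[OF conjunct2[OF law1]] conjunct2[OF conjunct2[OF law1]]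
  note law2 = assms(2)[unfolded weak_conservation_law_def, rule_format, OF \<phi>]
  note 2 = conjunct1[OF law2] conjunct1[OF conjunct2[OF law2]] conjunct2[OF conjunct2[OF law2]]
  have eq: "?h (\<lambda>z. w1 z + w2 z) (\<lambda>z. f1 z + f2 z) = (\<lambda>z. ?h w1 f1 z + ?h w2 f2 z)"
    by (auto simp: algebra_simps)
  show "set_integrable lborel ?D (?h (\<lambda>z. w1 z + w2 z) (\<lambda>z. f1 z + f2 z)) \<and>
      integrable lborel (\<lambda>x. (p1 x + p2 x) * \<phi> (0, x)) \<and>
      (LINT z:?D|lborel. ?h (\<lambda>z. w1 z + w2 z) (\<lambda>z. f1 z + f2 z) z)
        + (LINT x|lborel. (p1 x + p2 x) * \<phi> (0, x)) = 0"
    unfolding eq using set_integral_add[OF 1(1) 2(1)] 1(2,3) 2(2,3) by (simp add: distrib_right)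
qed

text \<open>
  The weak formulation sees only \<open>t > 0\<close> and does not see null sets of the initial line. The latter is
  used for the value of the Riemann data at 0.
\<close>

lemma weak_conservation_law_cong:
  assumes law: "weak_conservation_law w f p"
    and "\<And>t x. 0 < t \<Longrightarrow> w' (t, x) = w (t, x)" "\<And>t x. 0 < t \<Longrightarrow> f' (t, x) = f (t, x)"
    and p: "p \<in> borel_measurable borel" "p' \<in> borel_measurable borel" "AE x in lborel. p' x = p x"
  shows "weak_conservation_law w' f' p'"
  unfolding weak_conservation_law_def
proof (intro allI impI)
  fix \<phi> \<phi>t \<phi>x :: "real \<times> real \<Rightarrow> real"
  assume \<phi>: "test_function \<phi> \<phi>t \<phi>x"
  have eq: "indicator ({0<..} \<times> UNIV) z *\<^sub>R (w' z * \<phi>t z + f' z * \<phi>x z)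
      = indicator ({0<..} \<times> UNIV) z *\<^sub>R (w z * \<phi>t z + f z * \<phi>x z)" for z
    using assms(2,3) by (cases z) (auto simp: indicator_def)
  have "continuous_on UNIV (\<lambda>x. \<phi> (0, x))"
    by (rule test_function_initial_continuous[OF \<phi>])
  then have [measurable]: "(\<lambda>x. \<phi> (0, x)) \<in> borel_measurable borel"
    by (rule borel_measurable_continuous_onI)
  note [measurable] = p(1,2)
  have ae: "AE x in lborel. p' x * \<phi> (0, x) = p x * \<phi> (0, x)"
    using p(3) by eventually_elim simp
  have "integrable lborel (\<lambda>x. p' x * \<phi> (0, x)) \<longleftrightarrow> integrable lborel (\<lambda>x. p x * \<phi> (0, x))"
    by (rule integrable_cong_AE[OF _ _ ae]) measurable
  moreover have "(LINT x|lborel. p' x * \<phi> (0, x)) = (LINT x|lborel. p x * \<phi> (0, x))"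
    by (rule integral_cong_AE[OF _ _ ae]) measurable
  ultimately show "set_integrable lborel ({0<..} \<times> UNIV) (\<lambda>z. w' z * \<phi>t z + f' z * \<phi>x z) \<and>
      integrable lborel (\<lambda>x. p' x * \<phi> (0, x)) \<and>
      (LINT z:{0<..} \<times> UNIV|lborel. w' z * \<phi>t z + f' z * \<phi>x z)
        + (LINT x|lborel. p' x * \<phi> (0, x)) = 0"
    using law \<phi>
    unfolding weak_conservation_law_def set_integrable_def set_lebesgue_integral_def eq by simp
qed


section \<open>The vacuum solution of the zero-pressure system\<close>

text \<open>
  Because a vacuum separates the outer states, each of them is transported on its own with the speed
  of its edge, and since \<open>um < up\<close> the two regions never meet: the solution is a sum of two solutions of
  linear transport equations.
\<close>

lemma two_transported_states:
  fixes \<alpha> \<beta> um up :: real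
  assumes "um < up"
    and "\<And>t x. 0 < t \<Longrightarrow> w (t, x) = (if x / t < um then \<alpha> else if x / t \<le> up then 0 else \<beta>)"
    and "\<And>t x. 0 < t \<Longrightarrow> f (t, x) = (if x / t < um then um * \<alpha> else if x / t \<le> up then 0 else up * \<beta>)"
  shows "weak_conservation_law w f (riemann_data \<alpha> \<beta>)"
proof -
  let ?l = "\<lambda>y::real. \<alpha> * indicator {..<0} y" and ?r = "\<lambda>y::real. \<beta> * indicator {0<..} y"
  have meas: "?l \<in> borel_measurable borel" "?r \<in> borel_measurable borel"
    by measurable
  have bound: "\<bar>?l y\<bar> \<le> \<bar>\<alpha>\<bar>" "\<bar>?r y\<bar> \<le> \<bar>\<beta>\<bar>" for y
    by (simp_all add: indicator_def)
  have "weak_conservation_law (\<lambda>(t, x). ?l (x - um * t)) (\<lambda>(t, x). um * ?l (x - um * t)) ?l"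
    by (rule transport_weak_solution[OF meas(1) bound(1)])
  moreover have "weak_conservation_law (\<lambda>(t, x). ?r (x - up * t)) (\<lambda>(t, x). up * ?r (x - up * t)) ?r"
    by (rule transport_weak_solution[OF meas(2) bound(2)])
  ultimately have law: "weak_conservation_law
      (\<lambda>z. (case z of (t, x) \<Rightarrow> ?l (x - um * t)) + (case z of (t, x) \<Rightarrow> ?r (x - up * t)))
      (\<lambda>z. (case z of (t, x) \<Rightarrow> um * ?l (x - um * t)) + (case z of (t, x) \<Rightarrow> up * ?r (x - up * t)))
      (\<lambda>x. ?l x + ?r x)"
    by (rule weak_conservation_law_add)
  have region: "x / t < um \<longleftrightarrow> x - um * t < 0" "x / t \<le> up \<longleftrightarrow> \<not> 0 < x - up * t"
      "\<not> (x - um * t < 0 \<and> 0 < x - up * t)" if "0 < t" for t x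
  proof -
    show "x / t < um \<longleftrightarrow> x - um * t < 0" "x / t \<le> up \<longleftrightarrow> \<not> 0 < x - up * t"
      using that by (auto simp: field_simps)
    show "\<not> (x - um * t < 0 \<and> 0 < x - up * t)"
      using mult_strict_right_mono[OF assms(1) that] by auto
  qed
  show ?thesis
  proof (rule weak_conservation_law_cong[OF law])
    fix t x :: real assume t: "0 < t"
    show "w (t, x) = (case (t, x) of (t, x) \<Rightarrow> ?l (x - um * t)) + (case (t, x) of (t, x) \<Rightarrow> ?r (x - up * t))"
      using region[OF t, of x] by (simp add: assms(2)[OF t] indicator_def)
    show "f (t, x) = (case (t, x) of (t, x) \<Rightarrow> um * ?l (x - um * t)) + (case (t, x) of (t, x) \<Rightarrow> up * ?r (x - up * t))"
      using region[OF t, of x] by (simp add: assms(3)[OF t] indicator_def)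
  next
    show "(\<lambda>x. ?l x + ?r x) \<in> borel_measurable borel"
      using meas by (rule borel_measurable_add)
    show "riemann_data \<alpha> \<beta> \<in> borel_measurable borel"
      unfolding riemann_data_def[abs_def] by measurable
    show "AE x in lborel. riemann_data \<alpha> \<beta> x = ?l x + ?r x"
      using AE_lborel_singleton[of "0::real"]
      by eventually_elim (auto simp: riemann_data_def indicator_def)
  qed
qed

lemma vacuum_self_similar_solution:
  assumes "um < up"
  shows "self_similar_solution zero_pressure_mass_flux zero_pressure_momentum_flux \<rho>m um \<rho>p up
       (vacuum_density \<rho>m um \<rho>p up) (vacuum_velocity um up)"
  unfolding self_similar_solution_def
proof (intro conjI)
  let ?R = "vacuum_density \<rho>m um \<rho>p up" and ?U = "vacuum_velocity um up"
  have flux: "zero_pressure_mass_flux (?R \<xi>) (?U \<xi>)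
        = (if \<xi> < um then um * \<rho>m else if \<xi> \<le> up then 0 else up * \<rho>p)"
      "?R \<xi> * ?U \<xi> = (if \<xi> < um then \<rho>m * um else if \<xi> \<le> up then 0 else \<rho>p * up)"
      "zero_pressure_momentum_flux (?R \<xi>) (?U \<xi>)
        = (if \<xi> < um then um * (\<rho>m * um) else if \<xi> \<le> up then 0 else up * (\<rho>p * up))" for \<xi>
    by (simp_all add: vacuum_density_def vacuum_velocity_def zero_pressure_mass_flux_def
        zero_pressure_momentum_flux_def power2_eq_square)
  show "weak_conservation_law (\<lambda>(t, x). ?R (x / t))
      (\<lambda>(t, x). zero_pressure_mass_flux (?R (x / t)) (?U (x / t))) (riemann_data \<rho>m \<rho>p)"
    by (rule two_transported_states[OF assms]) (simp_all only: prod.case flux, simp only: vacuum_density_def)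
  show "weak_conservation_law (\<lambda>(t, x). ?R (x / t) * ?U (x / t))
      (\<lambda>(t, x). zero_pressure_momentum_flux (?R (x / t)) (?U (x / t)))
      (riemann_data (\<rho>m * um) (\<rho>p * up))"
    by (rule two_transported_states[OF assms]) (simp_all only: flux prod.case)
qed

lemma vacuum_contacts:
  assumes "um < up" "0 < \<rho>m" "0 < \<rho>p"
  shows "zero_pressure_contact um \<rho>m um 0 um (vacuum_density \<rho>m um \<rho>p up) (vacuum_velocity um up)"
    and "zero_pressure_contact up 0 up \<rho>p up (vacuum_density \<rho>m um \<rho>p up) (vacuum_velocity um up)"
proof -
  let ?R = "vacuum_density \<rho>m um \<rho>p up" and ?U = "vacuum_velocity um up"
  have l1: "\<forall>\<^sub>F \<xi> in at_left um. ?R \<xi> = \<rho>m \<and> ?U \<xi> = um"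
    using eventually_at_left_real[of "um - 1" um]
    by (auto elim!: eventually_mono simp: vacuum_density_def vacuum_velocity_def)
  have r1: "\<forall>\<^sub>F \<xi> in at_right um. ?R \<xi> = 0 \<and> ?U \<xi> = \<xi>"
    using eventually_at_right_real[OF assms(1)]
    by (auto elim!: eventually_mono simp: vacuum_density_def vacuum_velocity_def)
  have l2: "\<forall>\<^sub>F \<xi> in at_left up. ?R \<xi> = 0 \<and> ?U \<xi> = \<xi>"
    using eventually_at_left_real[OF assms(1)]
    by (auto elim!: eventually_mono simp: vacuum_density_def vacuum_velocity_def)
  have r2: "\<forall>\<^sub>F \<xi> in at_right up. ?R \<xi> = \<rho>p \<and> ?U \<xi> = up"
    using eventually_at_right_real[of up "up + 1"] assms(1)
    by (auto elim!: eventually_mono simp: vacuum_density_def vacuum_velocity_def)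
  have cong: "(h \<longlongrightarrow> s) (at s within A)" if "\<forall>\<^sub>F \<xi> in at s within A. h \<xi> = \<xi>" for h and s :: real and A
    using tendsto_cong[OF that] by (simp add: tendsto_ident_at)
  have "(?R \<longlongrightarrow> \<rho>m) (at_left um)" "(?U \<longlongrightarrow> um) (at_left um)"
    using l1 by (auto intro!: tendsto_eventually elim: eventually_mono)
  moreover have "(?R \<longlongrightarrow> 0) (at_right um)" "(?U \<longlongrightarrow> um) (at_right um)"
    using r1 by (auto intro!: tendsto_eventually cong elim: eventually_mono)
  ultimately show "zero_pressure_contact um \<rho>m um 0 um ?R ?U"
    using assms
    by (simp add: zero_pressure_contact_def zero_pressure_mass_flux_def
        zero_pressure_momentum_flux_def power2_eq_square)
  have "(?R \<longlongrightarrow> 0) (at_left up)" "(?U \<longlongrightarrow> up) (at_left up)"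
    using l2 by (auto intro!: tendsto_eventually cong elim: eventually_mono)
  moreover have "(?R \<longlongrightarrow> \<rho>p) (at_right up)" "(?U \<longlongrightarrow> up) (at_right up)"
    using r2 by (auto intro!: tendsto_eventually elim: eventually_mono)
  ultimately show "zero_pressure_contact up 0 up \<rho>p up ?R ?U"
    using assms
    by (simp add: zero_pressure_contact_def zero_pressure_mass_flux_def
        zero_pressure_momentum_flux_def power2_eq_square)
qed

section \<open>The vanishing pressure limit\<close>

lemma wave_width_tendsto: "((\<lambda>\<epsilon>2. wave_width \<gamma> \<epsilon>2 \<rho>) \<longlongrightarrow> 0) (at_right 0)"
proof -
  have "((\<lambda>\<epsilon>2. wave_width \<gamma> \<epsilon>2 \<rho>) \<longlongrightarrow> (1 + 2 / (min \<gamma> 2 - 1)) * sqrt (0 * \<rho> powr (\<gamma> - 1))) (at_right 0)"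
    unfolding wave_width_def by (intro tendsto_intros)
  then show ?thesis by simp
qed


theorem theorem6p1:
  fixes \<gamma> \<rho>m um \<rho>p up \<delta> :: real
    and R U :: "real \<Rightarrow> real \<Rightarrow> real \<Rightarrow> real"
    and a b c d :: "real \<Rightarrow> real \<Rightarrow> real"
  assumes "\<gamma> > 1" and "\<rho>m > 0" and "\<rho>p > 0" and "um < up"
    and "\<delta> > 0"
    and "\<And>\<epsilon>1 \<epsilon>2. 0 < \<epsilon>1 \<Longrightarrow> \<epsilon>1 < \<delta> \<Longrightarrow> 0 < \<epsilon>2 \<Longrightarrow> \<epsilon>2 < \<delta> \<Longrightarrow>
           two_rarefaction_solution \<gamma> \<epsilon>1 \<epsilon>2 \<rho>m um \<rho>p up
             (a \<epsilon>1 \<epsilon>2) (b \<epsilon>1 \<epsilon>2) (c \<epsilon>1 \<epsilon>2) (d \<epsilon>1 \<epsilon>2) (R \<epsilon>1 \<epsilon>2) (U \<epsilon>1 \<epsilon>2)"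
  shows
    "(\<exists>\<epsilon>0>0. \<forall>\<epsilon>1 \<epsilon>2. 0 < \<epsilon>1 \<and> \<epsilon>1 < \<epsilon>0 \<and> 0 < \<epsilon>2 \<and> \<epsilon>2 < \<epsilon>0 \<longrightarrow>
        constant_density_solution \<epsilon>1 (b \<epsilon>1 \<epsilon>2) (c \<epsilon>1 \<epsilon>2) (R \<epsilon>1 \<epsilon>2) (U \<epsilon>1 \<epsilon>2)) \<and>
     ((\<lambda>(\<epsilon>1, \<epsilon>2). a \<epsilon>1 \<epsilon>2) \<longlongrightarrow> um) (at_right 0 \<times>\<^sub>F at_right 0) \<and>
     ((\<lambda>(\<epsilon>1, \<epsilon>2). b \<epsilon>1 \<epsilon>2) \<longlongrightarrow> um) (at_right 0 \<times>\<^sub>F at_right 0) \<and>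
     ((\<lambda>(\<epsilon>1, \<epsilon>2). c \<epsilon>1 \<epsilon>2) \<longlongrightarrow> up) (at_right 0 \<times>\<^sub>F at_right 0) \<and>
     ((\<lambda>(\<epsilon>1, \<epsilon>2). d \<epsilon>1 \<epsilon>2) \<longlongrightarrow> up) (at_right 0 \<times>\<^sub>F at_right 0) \<and>
     (\<forall>\<xi>. \<xi> \<noteq> um \<and> \<xi> \<noteq> up \<longrightarrow>
        ((\<lambda>(\<epsilon>1, \<epsilon>2). (R \<epsilon>1 \<epsilon>2 \<xi>, U \<epsilon>1 \<epsilon>2 \<xi>)) \<longlongrightarrow>
          (vacuum_density \<rho>m um \<rho>p up \<xi>, vacuum_velocity um up \<xi>)) (at_right 0 \<times>\<^sub>F at_right 0)) \<and>
     zero_pressure_contact um \<rho>m um 0 um (vacuum_density \<rho>m um \<rho>p up) (vacuum_velocity um up) \<and>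
     zero_pressure_contact up 0 up \<rho>p up (vacuum_density \<rho>m um \<rho>p up) (vacuum_velocity um up) \<and>
     self_similar_solution zero_pressure_mass_flux zero_pressure_momentum_flux \<rho>m um \<rho>p up
       (vacuum_density \<rho>m um \<rho>p up) (vacuum_velocity um up)"
proof -
  let ?F = "at_right (0::real) \<times>\<^sub>F at_right (0::real)"
  let ?w = "\<lambda>\<rho> (\<epsilon>1::real, \<epsilon>2). wave_width \<gamma> \<epsilon>2 \<rho>"
  have pos: "\<forall>\<^sub>F (\<epsilon>1, \<epsilon>2) in ?F. 0 < \<epsilon>1 \<and> \<epsilon>1 < \<delta> \<and> 0 < \<epsilon>2 \<and> \<epsilon>2 < \<delta>"
  proof -
    have "\<forall>\<^sub>F \<epsilon> in at_right 0. 0 < \<epsilon> \<and> \<epsilon> < \<delta>"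
      using eventually_at_right_real[OF \<open>\<delta> > 0\<close>] by (auto elim: eventually_mono)
    from eventually_prodI[OF this this] show ?thesis
      by (simp add: case_prod_unfold conj_assoc)
  qed
  have width: "(?w \<rho> \<longlongrightarrow> 0) ?F" for \<rho>
    using filterlim_compose[OF wave_width_tendsto filterlim_snd, of \<gamma> \<rho> "at_right (0::real)"]
    by (simp add: case_prod_unfold)
  have squeeze: "((\<lambda>(\<epsilon>1, \<epsilon>2). e \<epsilon>1 \<epsilon>2) \<longlongrightarrow> l) ?F"
    if "\<And>\<epsilon>1 \<epsilon>2. 0 < \<epsilon>1 \<Longrightarrow> \<epsilon>1 < \<delta> \<Longrightarrow> 0 < \<epsilon>2 \<Longrightarrow> \<epsilon>2 < \<delta> \<Longrightarrow> \<bar>e \<epsilon>1 \<epsilon>2 - l\<bar> \<le> wave_width \<gamma> \<epsilon>2 \<rho>" for e l \<rho>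
  proof (rule LIM_zero_cancel, rule Lim_null_comparison[OF _ width[of \<rho>]])
    show "\<forall>\<^sub>F z in ?F. norm ((case z of (\<epsilon>1, \<epsilon>2) \<Rightarrow> e \<epsilon>1 \<epsilon>2) - l) \<le> ?w \<rho> z"
      using pos by eventually_elim (auto intro: that)
  qed
  note est = two_rarefaction_estimates[OF assms(1) _ _ assms(6)]
  have A: "((\<lambda>(\<epsilon>1, \<epsilon>2). a \<epsilon>1 \<epsilon>2) \<longlongrightarrow> um) ?F" by (rule squeeze[OF est(1)])
  have B: "((\<lambda>(\<epsilon>1, \<epsilon>2). b \<epsilon>1 \<epsilon>2) \<longlongrightarrow> um) ?F" by (rule squeeze[OF est(2)])
  have C: "((\<lambda>(\<epsilon>1, \<epsilon>2). c \<epsilon>1 \<epsilon>2) \<longlongrightarrow> up) ?F" by (rule squeeze[OF est(3)])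
  have D: "((\<lambda>(\<epsilon>1, \<epsilon>2). d \<epsilon>1 \<epsilon>2) \<longlongrightarrow> up) ?F" by (rule squeeze[OF est(4)])
  \<comment> \<open>Once the two widths together are less than \<open>up - um\<close>, there is no room for a constant state.\<close>
  have "((\<lambda>\<epsilon>2. wave_width \<gamma> \<epsilon>2 \<rho>m + wave_width \<gamma> \<epsilon>2 \<rho>p) \<longlongrightarrow> 0) (at_right 0)"
    using tendsto_add[OF wave_width_tendsto wave_width_tendsto] by simp
  then have "\<forall>\<^sub>F \<epsilon>2 in at_right 0. wave_width \<gamma> \<epsilon>2 \<rho>m + wave_width \<gamma> \<epsilon>2 \<rho>p < up - um"
    using assms(4) by (auto intro: order_tendstoD)
  then obtain e where e: "0 < e" "\<And>\<epsilon>2. 0 < \<epsilon>2 \<Longrightarrow> \<epsilon>2 < e \<Longrightarrow> wave_width \<gamma> \<epsilon>2 \<rho>m + wave_width \<gamma> \<epsilon>2 \<rho>p < up - um"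
    by (auto simp: eventually_at_right_field)
  have E: "constant_density_solution \<epsilon>1 (b \<epsilon>1 \<epsilon>2) (c \<epsilon>1 \<epsilon>2) (R \<epsilon>1 \<epsilon>2) (U \<epsilon>1 \<epsilon>2)"
    if "0 < \<epsilon>1" "\<epsilon>1 < min \<delta> e" "0 < \<epsilon>2" "\<epsilon>2 < min \<delta> e" for \<epsilon>1 \<epsilon>2
    using est(5)[of \<epsilon>1 \<epsilon>2] e(2)[of \<epsilon>2] that by simp
  have e0: "0 < min \<delta> e" using assms(5) e(1) by simp
  have cds: "\<forall>\<^sub>F (\<epsilon>1, \<epsilon>2) in ?F. constant_density_solution \<epsilon>1 (b \<epsilon>1 \<epsilon>2) (c \<epsilon>1 \<epsilon>2) (R \<epsilon>1 \<epsilon>2) (U \<epsilon>1 \<epsilon>2)"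
  proof -
    have "\<forall>\<^sub>F \<epsilon> in at_right 0. 0 < \<epsilon> \<and> \<epsilon> < min \<delta> e"
      using eventually_at_right_real[OF e0] by (auto elim: eventually_mono)
    from eventually_prodI[OF this this] show ?thesis
      by (rule eventually_mono) (auto intro!: E)
  qed
  have P: "((\<lambda>(\<epsilon>1, \<epsilon>2). (R \<epsilon>1 \<epsilon>2 \<xi>, U \<epsilon>1 \<epsilon>2 \<xi>)) \<longlongrightarrow>
      (vacuum_density \<rho>m um \<rho>p up \<xi>, vacuum_velocity um up \<xi>)) ?F" if "\<xi> \<noteq> um" "\<xi> \<noteq> up" for \<xi>
  proof -
    \<comment> \<open>The edges of both waves converge, so that \<open>\<xi>\<close> lies outside of both of them in the limit.\<close>
    consider "\<xi> < um" | "um < \<xi>" "\<xi> < up" | "up < \<xi>" using \<open>\<xi> \<noteq> um\<close> \<open>\<xi> \<noteq> up\<close> by linarith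
    then show ?thesis
    proof cases
      case 1
      have "\<forall>\<^sub>F (\<epsilon>1, \<epsilon>2) in ?F. (R \<epsilon>1 \<epsilon>2 \<xi>, U \<epsilon>1 \<epsilon>2 \<xi>) = (\<rho>m, um)"
        using pos order_tendstoD(1)[OF A 1]
      proof eventually_elim
        case (elim z)
        then show ?case using assms(6)[of "fst z" "snd z"]
          by (auto simp: two_rarefaction_solution_def case_prod_unfold)
      qed
      then show ?thesis using 1 assms(4)
        by (intro tendsto_eventually) (simp add: vacuum_density_def vacuum_velocity_def case_prod_unfold)
    next
      case 2
      have "\<forall>\<^sub>F (\<epsilon>1, \<epsilon>2) in ?F. (2 * \<epsilon>1, \<xi>) = (R \<epsilon>1 \<epsilon>2 \<xi>, U \<epsilon>1 \<epsilon>2 \<xi>)"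
        using cds order_tendstoD(2)[OF B 2(1)] order_tendstoD(1)[OF C 2(2)]
      proof eventually_elim
        case (elim z)
        then show ?case
          by (auto simp: constant_density_solution_def case_prod_unfold)
      qed
      moreover have "((\<lambda>(\<epsilon>1, \<epsilon>2::real). (2 * \<epsilon>1, \<xi>)) \<longlongrightarrow> (0, \<xi>)) ?F"
      proof -
        have "((\<lambda>\<epsilon>::real. 2 * \<epsilon>) \<longlongrightarrow> 2 * 0) (at_right 0)" by (intro tendsto_intros)
        then have "((\<lambda>z. 2 * fst z) \<longlongrightarrow> 0) ?F"
          using filterlim_compose[OF _ filterlim_fst] by fastforce
        then show ?thesis
          unfolding case_prod_unfold by (intro tendsto_Pair tendsto_const)
      qed
      ultimately have "((\<lambda>(\<epsilon>1, \<epsilon>2). (R \<epsilon>1 \<epsilon>2 \<xi>, U \<epsilon>1 \<epsilon>2 \<xi>)) \<longlongrightarrow> (0, \<xi>)) ?F"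
        by (elim Lim_transform_eventually) (simp add: case_prod_unfold)
      then show ?thesis using 2 by (simp add: vacuum_density_def vacuum_velocity_def)
    next
      case 3
      have "\<forall>\<^sub>F (\<epsilon>1, \<epsilon>2) in ?F. (R \<epsilon>1 \<epsilon>2 \<xi>, U \<epsilon>1 \<epsilon>2 \<xi>) = (\<rho>p, up)"
        using pos order_tendstoD(2)[OF D 3]
      proof eventually_elim
        case (elim z)
        then show ?case using assms(6)[of "fst z" "snd z"]
          by (auto simp: two_rarefaction_solution_def case_prod_unfold)
      qed
      then show ?thesis using 3 assms(4)
        by (intro tendsto_eventually) (simp add: vacuum_density_def vacuum_velocity_def case_prod_unfold)
    qed
  qed
  have "\<exists>\<epsilon>0>0. \<forall>\<epsilon>1 \<epsilon>2. 0 < \<epsilon>1 \<and> \<epsilon>1 < \<epsilon>0 \<and> 0 < \<epsilon>2 \<and> \<epsilon>2 < \<epsilon>0 \<longrightarrow>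
        constant_density_solution \<epsilon>1 (b \<epsilon>1 \<epsilon>2) (c \<epsilon>1 \<epsilon>2) (R \<epsilon>1 \<epsilon>2) (U \<epsilon>1 \<epsilon>2)"
    using E e0 by blast
  then show ?thesis
    using A B C D P vacuum_contacts[OF assms(4) assms(2,3)] vacuum_self_similar_solution[OF assms(4)]
    by blast
qed

end
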